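(* Let $T$ be a set with a distinguished element $\bot\in T$, and let a class of total maps $\mathbb{N}\to T$, called enumerations, be given satisfying: (1) if $\nu$ is an enumeration and $f:\mathbb{N}\to\mathbb{N}$ is partial computable, then $\mu(n)=\nu(f(n))$ if $f(n)$ is defined and $\mu(n)=\bot$ otherwise defines an enumeration $\mu$; (2) there is an enumeration $\nu$ such that for every enumeration $\mu$ there is a total computable $h$ with $\mu(n)=\nu(h(n))$ for all $n$; (3) for every enumeration $\tau$ and every enumerable set $G\subseteq\mathbb{N}$ there is an enumeration $\rho$ with $\rho(x)=\tau(x)$ for $x\notin G$ and $\rho(x)\ne\bot$ for $x\in G$. Let $\nu$ and $\nu'$ be two effectively optimal enumerations. Then there exists a computable bijection $h:\mathbb{N}\to\mathbb{N}$ such that both $h$ and $h^{-1}$ are length-bounded and $\nu'(x)=\nu(h(x))$ for all $x\in\mathbb{N}$.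
   Context: Natural numbers are identified with binary strings in the standard (length-lexicographic) way. A total function $h$ is length-bounded if $|h(x)|\le|x|+c$ for some $c$ and all $x$ (equivalently, $h(n)=O(n)$ for natural numbers). An enumeration $\omega$ is effectively optimal if for every enumeration $\mu$ there exists a total computable length-bounded $h$ with $\mu(x)=\omega(h(x))$ for all $x$. *)

theory Defs
  imports Main
begin

datatype recf =
    Z
  | S
  | Id nat
  | Cn recf "recf list"
  | Pr recf recf
  | Mn recf

inductive eval :: "recf \<Rightarrow> nat list \<Rightarrow> nat \<Rightarrow> bool" where
  eval_Z: "eval Z xs 0"
| eval_S: "eval S (x # xs) (Suc x)"
| eval_Id: "i < length xs \<Longrightarrow> eval (Id i) xs (xs ! i)"
| eval_Cn: "list_all2 (\<lambda>g y. eval g xs y) gs ys \<Longrightarrow> eval f ys y \<Longrightarrow> eval (Cn f gs) xs y"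
| eval_Pr0: "eval f xs y \<Longrightarrow> eval (Pr f g) (0 # xs) y"
| eval_PrS: "eval (Pr f g) (n # xs) z \<Longrightarrow> eval g (z # n # xs) y \<Longrightarrow> eval (Pr f g) (Suc n # xs) y"
| eval_Mn: "eval f (y # xs) 0 \<Longrightarrow> (\<forall>k<y. \<exists>z. eval f (k # xs) (Suc z))
            \<Longrightarrow> eval (Mn f) xs y"

definition partial_computable :: "(nat \<Rightarrow> nat option) \<Rightarrow> bool" where
  "partial_computable f \<longleftrightarrow> (\<exists>r. \<forall>n y. eval r [n] y \<longleftrightarrow> f n = Some y)"

definition total_computable :: "(nat \<Rightarrow> nat) \<Rightarrow> bool" where
  "total_computable h \<longleftrightarrow> partial_computable (\<lambda>n. Some (h n))"

definition enumerable :: "nat set \<Rightarrow> bool" where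
  "enumerable G \<longleftrightarrow> (\<exists>f. partial_computable f \<and> G = {n. f n \<noteq> None})"

text \<open>Under the standard bijection (0 = empty string, 1 = "0", 2 = "1", 3 = "00", ...),
  the string corresponding to \<open>n\<close> is the binary expansion of \<open>n+1\<close> without its leading 1,
  so its length is the largest \<open>k\<close> with \<open>2^k \<le> n + 1\<close>.\<close>
definition blen :: "nat \<Rightarrow> nat" where
  "blen n = (GREATEST k. 2 ^ k \<le> n + 1)"

definition length_bounded :: "(nat \<Rightarrow> nat) \<Rightarrow> bool" where
  "length_bounded h \<longleftrightarrow> (\<exists>c. \<forall>x. blen (h x) \<le> blen x + c)"

definition effectively_optimal :: "(nat \<Rightarrow> 'a) set \<Rightarrow> (nat \<Rightarrow> 'a) \<Rightarrow> bool" where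
  "effectively_optimal E \<omega> \<longleftrightarrow> \<omega> \<in> E \<and>
     (\<forall>\<mu>\<in>E. \<exists>h. total_computable h \<and> length_bounded h \<and> (\<forall>x. \<mu> x = \<omega> (h x)))"

end

theory Submission
  imports Defs "HOL-Library.Nat_Bijection"
begin

text \<open>
  It suffices to find, for an enumeration \<open>\<mu>\<close>, a computable, injective, length-bounded \<open>f\<close> with
  \<open>x < f x\<close> and \<open>\<mu> x = \<nu> (f x)\<close>: given such maps in both directions, the backward chains of the
  Schroeder--Bernstein argument terminate, so its bijection is computable, and it is length-bounded
  because it follows the edges of the two maps.

  To find \<open>f\<close>, one defines a new enumeration \<open>\<rho>\<close> at the pairs \<open>(e, z)\<close>, where \<open>e\<close> is a program meant
  to compute the reduction of \<open>\<rho>\<close> to \<open>\<nu>\<close>, so that it may be used in the construction. If \<open>e\<close> maps two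
  pairs \<open>(e, y)\<close>, \<open>(e, x)\<close> to the same value, then \<open>\<rho>\<close> is made non-bottom at the first pair of its
  collision class (by the third axiom) and bottom at the others, so the true reduction has no
  collisions. Without collisions, at most \<open>x + 1\<close> of the images are \<open>\<le> x\<close>; \<open>\<rho>\<close> copies \<open>\<mu> k\<close>
  to \<open>(e, z)\<close>, where the counter \<open>k\<close> advances whenever the image of \<open>(e, z)\<close> exceeds it, and \<open>f x\<close>
  is the image at which the counter leaves \<open>x\<close>, which happens for some \<open>z \<le> 2 * x + 1\<close>.
\<close>

section \<open>A calculus of computable functions and semidecidable predicates\<close>

inductive_simps eval_Z_iff: "eval Z xs y"
inductive_simps eval_S_iff: "eval S xs y"
inductive_simps eval_Id_iff: "eval (Id i) xs y"
inductive_simps eval_Cn_iff: "eval (Cn f gs) xs y"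
inductive_simps eval_Pr0_iff: "eval (Pr f g) (0 # xs) y"
inductive_simps eval_PrS_iff: "eval (Pr f g) (Suc n # xs) y"
inductive_simps eval_Mn_iff: "eval (Mn f) xs y"

text \<open>The argument of \<open>F\<close> is an environment of de Bruijn variables, of which \<open>F\<close> uses finitely many;
  under a binder the outer environment becomes \<open>\<lambda>i. v (Suc i)\<close>, so that beta reduction performs all
  substitutions.\<close>

definition computable :: "((nat \<Rightarrow> nat) \<Rightarrow> nat) \<Rightarrow> bool" where
  "computable F \<longleftrightarrow> (\<exists>r N. \<forall>n\<ge>N. \<forall>v y. eval r (map v [0..<n]) y \<longleftrightarrow> y = F v)"

lemma eval_Cn_functional:
  assumes "\<And>i y. i < length gs \<Longrightarrow> eval (gs ! i) xs y \<longleftrightarrow> y = G i"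
  shows "eval (Cn f gs) xs y \<longleftrightarrow> eval f (map G [0..<length gs]) y"
proof -
  have "list_all2 (\<lambda>g. eval g xs) gs ys \<longleftrightarrow> ys = map G [0..<length gs]" for ys
  proof
    assume "list_all2 (\<lambda>g. eval g xs) gs ys"
    then show "ys = map G [0..<length gs]"
      by (intro nth_equalityI) (simp_all add: list_all2_conv_all_nth assms)
  next
    assume "ys = map G [0..<length gs]"
    then show "list_all2 (\<lambda>g. eval g xs) gs ys"
      by (simp add: list_all2_conv_all_nth assms)
  qed
  then show ?thesis unfolding eval_Cn_iff by simp
qed

text \<open>\<open>F\<close> depends only on variables below \<open>N\<close>, so its program is
  composed with the programs of \<open>\<sigma> i\<close> for \<open>i < N\<close>.\<close>

lemma computable_subst:
  assumes "computable F" and \<sigma>: "\<And>i. computable (\<sigma> i)"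
  shows "computable (\<lambda>v. F (\<lambda>i. \<sigma> i v))"
proof -
  obtain r N where r: "\<And>n v y. n \<ge> N \<Longrightarrow> eval r (map v [0..<n]) y \<longleftrightarrow> y = F v"
    using assms(1) unfolding computable_def by blast
  obtain \<rho> M where \<rho>: "\<And>i n v y. n \<ge> M i \<Longrightarrow> eval (\<rho> i) (map v [0..<n]) y \<longleftrightarrow> y = \<sigma> i v"
    using \<sigma> unfolding computable_def by metis
  \<comment> \<open>The sum is a common upper bound for the arities \<open>M i\<close> with
    \<open>i < N\<close>.\<close>
  have "eval (Cn r (map \<rho> [0..<N])) (map v [0..<n]) y \<longleftrightarrow> y = F (\<lambda>i. \<sigma> i v)"
    if n: "n \<ge> sum M {..<N}" for n v y
  proof -
    have "M i \<le> n" if "i < N" for i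
      using n member_le_sum[of i "{..<N}" M] that by auto
    then show ?thesis
      using r[OF order_refl, of "\<lambda>i. \<sigma> i v" y] \<rho>
      by (subst eval_Cn_functional[where G = "\<lambda>i. \<sigma> i v"]) auto
  qed
  then show ?thesis unfolding computable_def by blast
qed

lemma computable_var: "computable (\<lambda>v. v i)"
  unfolding computable_def by (rule exI[of _ "Id i"], rule exI[of _ "Suc i"]) (auto simp: eval_Id_iff)

lemma computable_Suc:
  assumes "computable F" shows "computable (\<lambda>v. Suc (F v))"
proof -
  obtain r N where "\<And>n v y. n \<ge> N \<Longrightarrow> eval r (map v [0..<n]) y \<longleftrightarrow> y = F v"
    using assms unfolding computable_def by blast
  then show ?thesis unfolding computable_def
    by (intro exI[of _ "Cn S [r]"] exI[of _ N]) (auto simp: eval_Cn_iff list_all2_Cons1 eval_S_iff)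
qed

lemma computable_const: "computable (\<lambda>v. c)"
proof (induction c)
  case 0
  then show ?case unfolding computable_def by (intro exI[of _ Z]) (simp add: eval_Z_iff)
next
  case (Suc c)
  then show ?case by (rule computable_Suc)
qed

lemma map_case_nat: "map (case_nat k v) [0..<Suc n] = k # map v [0..<n]"
  by (subst map_upt_Suc) simp

text \<open>The search by \<open>Mn\<close> is total: \<open>F\<close> is defined everywhere and a
  zero exists.\<close>

lemma computable_Least:
  assumes F: "computable (\<lambda>v. F (v 0) (\<lambda>i. v (Suc i)))" and ex: "\<And>v. \<exists>y. F y v = 0"
  shows "computable (\<lambda>v. LEAST y. F y v = 0)"
proof -
  obtain r N where r: "\<And>n v y. n \<ge> N \<Longrightarrow> eval r (map v [0..<n]) y \<longleftrightarrow> y = F (v 0) (\<lambda>i. v (Suc i))"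
    using F unfolding computable_def by blast
  have r': "eval r (k # map v [0..<n]) z \<longleftrightarrow> z = F k v" if "n \<ge> N" for k v n z
    using r[of "Suc n" "case_nat k v" z] that by (simp only: map_case_nat) simp
  have nz: "(\<exists>z. Suc z = a) \<longleftrightarrow> a \<noteq> 0" for a
    by (cases a) auto
  have "eval (Mn r) (map v [0..<n]) y \<longleftrightarrow> F y v = 0 \<and> (\<forall>k<y. F k v \<noteq> 0)" if "n \<ge> N" for v n y
    unfolding eval_Mn_iff r'[OF that] nz by (rule conj_cong[OF eq_commute refl])
  moreover have "F y v = 0 \<and> (\<forall>k<y. F k v \<noteq> 0) \<longleftrightarrow> y = (LEAST y. F y v = 0)" for v y
  proof
    assume "F y v = 0 \<and> (\<forall>k<y. F k v \<noteq> 0)"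
    then show "y = (LEAST y. F y v = 0)"
      by (intro Least_equality[symmetric]) (auto simp: not_less[symmetric])
  next
    assume "y = (LEAST y. F y v = 0)"
    then show "F y v = 0 \<and> (\<forall>k<y. F k v \<noteq> 0)"
      using LeastI_ex[OF ex[of v]] not_less_Least by blast
  qed
  ultimately have "eval (Mn r) (map v [0..<n]) y \<longleftrightarrow> y = (LEAST y. F y v = 0)" if "n \<ge> N" for v n y
    using that by simp
  then show ?thesis unfolding computable_def by (intro exI allI impI)
qed

lemma computable_rec_nat:
  assumes F: "computable F" and G: "computable (\<lambda>v. G (v 1) (v 0) (\<lambda>i. v (Suc (Suc i))))"
    and H: "computable H"
  shows "computable (\<lambda>v. rec_nat (F v) (\<lambda>k z. G k z v) (H v))"
proof -
  obtain f N where f: "\<And>n v y. n \<ge> N \<Longrightarrow> eval f (map v [0..<n]) y \<longleftrightarrow> y = F v"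
    using F unfolding computable_def by blast
  obtain g M where g: "\<And>n v y. n \<ge> M \<Longrightarrow> eval g (map v [0..<n]) y \<longleftrightarrow> y = G (v 1) (v 0) (\<lambda>i. v (Suc (Suc i)))"
    using G unfolding computable_def by blast
  have g': "eval g (z # k # map v [0..<n]) y \<longleftrightarrow> y = G k z v" if "n \<ge> M" for z k v n y
    using g[of "Suc (Suc n)" "case_nat z (case_nat k v)" y] that by (simp only: map_case_nat) simp
  have "eval (Pr f g) (k # map v [0..<n]) y \<longleftrightarrow> y = rec_nat (F v) (\<lambda>k z. G k z v) k"
    if "n \<ge> max N M" for k v n y
    using that by (induction k arbitrary: y) (simp_all add: eval_Pr0_iff eval_PrS_iff f g')
  note Pr = this
  have "eval (Pr f g) (map v [0..<n]) y \<longleftrightarrow>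
      y = rec_nat (F (\<lambda>i. v (Suc i))) (\<lambda>k z. G k z (\<lambda>i. v (Suc i))) (v 0)"
    if n: "n \<ge> Suc (max N M)" for v n y
  proof -
    obtain m where m: "n = Suc m" "m \<ge> max N M"
      using n by (cases n) auto
    show ?thesis
      using Pr[OF m(2), of "v 0" "\<lambda>i. v (Suc i)" y] unfolding m(1) map_upt_Suc .
  qed
  then have *: "computable (\<lambda>v. rec_nat (F (\<lambda>i. v (Suc i))) (\<lambda>k z. G k z (\<lambda>i. v (Suc i))) (v 0))"
    unfolding computable_def by blast
  \<comment> \<open>Substituting \<open>H\<close> for variable 0 turns recursion along that variable
    into recursion up to \<open>H v\<close>.\<close>
  have "computable (case_nat H (\<lambda>i v. v i) i)" for i
    using H computable_var by (cases i) auto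
  from computable_subst[OF *, of "case_nat H (\<lambda>i v. v i)", OF this] show ?thesis by simp
qed

section \<open>Arithmetic on computable functions\<close>

lemma computable_comp1:
  assumes "computable (\<lambda>v. f (v 0))" "computable F"
  shows "computable (\<lambda>v. f (F v))"
  using computable_subst[OF assms(1), of "\<lambda>_. F"] assms(2) by simp

lemma computable_comp2:
  assumes "computable (\<lambda>v. f (v 0) (v 1))" "computable F" "computable G"
  shows "computable (\<lambda>v. f (F v) (G v))"
  using computable_subst[OF assms(1), of "case_nat F (\<lambda>_. G)"] assms(2,3) by (simp split: nat.split)

lemma computable_add:
  assumes "computable F" "computable G" shows "computable (\<lambda>v. F v + G v)"
proof -
  have "a + b = rec_nat a (\<lambda>k z. Suc z) b" for a b :: nat
    by (induction b) auto
  then show ?thesis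
    by (simp only:) (intro computable_rec_nat computable_Suc computable_var assms)
qed

lemma computable_mult:
  assumes "computable F" "computable G" shows "computable (\<lambda>v. F v * G v)"
proof -
  have *: "a * b = rec_nat 0 (\<lambda>k z. z + a) b" for a b :: nat
    by (induction b) auto
  have "computable (\<lambda>v. v 0 * v 1)"
    unfolding * by (intro computable_rec_nat computable_add computable_const computable_var)
  from computable_comp2[OF this assms] show ?thesis .
qed

lemma computable_power:
  assumes "computable F" "computable G" shows "computable (\<lambda>v. F v ^ G v)"
proof -
  have *: "a ^ b = rec_nat 1 (\<lambda>k z. z * a) b" for a b :: nat
    by (induction b) auto
  have "computable (\<lambda>v. v 0 ^ v 1)"
    unfolding * by (intro computable_rec_nat computable_mult computable_const computable_var)
  from computable_comp2[OF this assms] show ?thesis .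
qed

lemma computable_diff:
  assumes "computable F" "computable G" shows "computable (\<lambda>v. F v - G v)"
proof -
  have pred: "rec_nat 0 (\<lambda>k z. k) z = z - 1" for z :: nat
    by (cases z) auto
  have *: "a - b = rec_nat a (\<lambda>k z. rec_nat 0 (\<lambda>k z. k) z) b" for a b :: nat
    by (induction b) (simp_all add: pred flip: diff_Suc_eq_diff_pred)
  have "computable (\<lambda>v. v 0 - v 1)"
    unfolding * by (intro computable_rec_nat computable_const computable_var)
  from computable_comp2[OF this assms] show ?thesis .
qed

lemma computable_prod_encode:
  assumes "computable F" "computable G" shows "computable (\<lambda>v. prod_encode (F v, G v))"
proof -
  have *: "triangle n = rec_nat 0 (\<lambda>k z. z + Suc k) n" for n
    by (induction n) auto
  have "computable (\<lambda>v. triangle (v 0))"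
    unfolding * by (intro computable_rec_nat computable_add computable_Suc computable_const computable_var)
  note tri = computable_comp1[OF this]
  show ?thesis
    unfolding prod_encode_def prod.case by (intro computable_add tri assms)
qed

section \<open>Decidable predicates\<close>

text \<open>Truth is coded by 0 because minimisation searches for zeros.\<close>

definition decidable :: "((nat \<Rightarrow> nat) \<Rightarrow> bool) \<Rightarrow> bool" where
  "decidable P \<longleftrightarrow> computable (\<lambda>v. if P v then 0 else 1)"

lemma decidable_zero:
  assumes "computable F" shows "decidable (\<lambda>v. F v = 0)"
proof -
  have *: "(if a = 0 then 0 else 1) = rec_nat 0 (\<lambda>_ _. 1) a" for a :: nat
    by (cases a) auto
  show ?thesis unfolding decidable_def *
    by (intro computable_rec_nat computable_const assms)
qed

lemma decidable_le:
  assumes "computable F" "computable G" shows "decidable (\<lambda>v. F v \<le> G v)"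
  using decidable_zero[OF computable_diff[OF assms]] by simp

lemma decidable_not:
  assumes "decidable P" shows "decidable (\<lambda>v. \<not> P v)"
proof -
  have "computable (\<lambda>v. 1 - (if P v then 0 else 1))"
    using assms unfolding decidable_def by (intro computable_diff computable_const)
  then show ?thesis unfolding decidable_def
    by (rule back_subst[of computable]) auto
qed

lemma decidable_conj:
  assumes "decidable P" "decidable Q" shows "decidable (\<lambda>v. P v \<and> Q v)"
proof -
  have "decidable (\<lambda>v. (if P v then 0 else 1) + (if Q v then 0 else 1) = (0::nat))"
    using assms unfolding decidable_def[of P] decidable_def[of Q]
    by (intro decidable_zero computable_add)
  then show ?thesis by (rule back_subst[of decidable]) auto
qed

lemma decidable_disj:
  assumes "decidable P" "decidable Q" shows "decidable (\<lambda>v. P v \<or> Q v)"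
  using decidable_not[OF decidable_conj[OF assms[THEN decidable_not]]] by simp

lemma decidable_less:
  assumes "computable F" "computable G" shows "decidable (\<lambda>v. F v < G v)"
  using decidable_not[OF decidable_le[OF assms(2,1)]] by (simp add: not_le)

lemma decidable_eq:
  assumes "computable F" "computable G" shows "decidable (\<lambda>v. F v = G v)"
  using decidable_conj[OF decidable_le[OF assms] decidable_le[OF assms(2,1)]]
  by (rule back_subst[of decidable]) auto

lemma computable_LEAST:
  assumes "decidable (\<lambda>v. P (v 0) (\<lambda>i. v (Suc i)))" "\<And>v. \<exists>y. P y v"
  shows "computable (\<lambda>v. LEAST y. P y v)"
proof -
  have "computable (\<lambda>v. LEAST y. (if P y v then 0 else 1) = (0::nat))"
    using assms unfolding decidable_def by (intro computable_Least) auto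
  then show ?thesis by (rule back_subst[of computable]) (auto intro!: ext arg_cong[of _ _ Least])
qed

lemma decidable_shift:
  assumes "decidable P" shows "decidable (\<lambda>v. P (\<lambda>i. v (Suc i)))"
  using computable_subst[OF assms[unfolded decidable_def], of "\<lambda>i v. v (Suc i)"] computable_var
  unfolding decidable_def by blast

lemma computable_shift:
  assumes "computable F" shows "computable (\<lambda>v. F (\<lambda>i. v (Suc i)))"
  using computable_subst[OF assms, of "\<lambda>i v. v (Suc i)"] computable_var by blast

lemma decidable_subst:
  assumes "decidable P" "\<And>i. computable (\<sigma> i)" shows "decidable (\<lambda>v. P (\<lambda>i. \<sigma> i v))"
  using computable_subst[OF assms(1)[unfolded decidable_def] assms(2)] unfolding decidable_def .

text \<open>Bounded search as a total minimisation: the stopping condition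
  \<open>B v \<le> k\<close> makes the search end, and it ends below \<open>B v\<close> exactly if a
  witness exists.\<close>

lemma decidable_bex:
  assumes B: "computable B" and P: "decidable (\<lambda>v. P (v 0) (\<lambda>i. v (Suc i)))"
  shows "decidable (\<lambda>v. \<exists>k<B v. P k v)"
proof -
  have "computable (\<lambda>v. LEAST k. B v \<le> k \<or> P k v)"
    using P by (intro computable_LEAST decidable_disj decidable_le computable_var computable_shift[OF B]) auto
  then have "decidable (\<lambda>v. (LEAST k. B v \<le> k \<or> P k v) < B v)"
    by (intro decidable_less B)
  moreover have "(LEAST k. b \<le> k \<or> Q k) < b \<longleftrightarrow> (\<exists>k<b. Q k)" for b :: nat and Q
  proof
    assume "(LEAST k. b \<le> k \<or> Q k) < b"
    then show "\<exists>k<b. Q k"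
      using LeastI[of "\<lambda>k. b \<le> k \<or> Q k" b] by (metis leD order_refl)
  next
    assume "\<exists>k<b. Q k"
    then obtain k where "k < b" "Q k" by blast
    then show "(LEAST k. b \<le> k \<or> Q k) < b"
      using Least_le[of "\<lambda>k. b \<le> k \<or> Q k" k] by auto
  qed
  ultimately show ?thesis by simp
qed

lemma decidable_ball:
  assumes B: "computable B" and P: "decidable (\<lambda>v. P (v 0) (\<lambda>i. v (Suc i)))"
  shows "decidable (\<lambda>v. \<forall>k<B v. P k v)"
  using decidable_not[OF decidable_bex[OF B decidable_not[OF P]]] by simp

lemma decidable_set_decode:
  assumes "computable F" "computable G" shows "decidable (\<lambda>v. F v \<in> set_decode (G v))"
proof -
  \<comment> \<open>Bit \<open>n\<close> is set iff the quotient by \<open>2 ^ n\<close> is odd;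
    bounded quantifiers over quotient and remainder reduce this to addition, multiplication and
    powers.\<close>
  have *: "n \<in> set_decode w \<longleftrightarrow> (\<exists>q<Suc w. \<exists>r<2 ^ n. w = (2 * q + 1) * 2 ^ n + r)" for n w
  proof
    assume "n \<in> set_decode w"
    then obtain q where q: "w div 2 ^ n = 2 * q + 1"
      by (auto simp: set_decode_def elim: oddE)
    then have "w = (2 * q + 1) * 2 ^ n + w mod 2 ^ n"
      by (metis div_mult_mod_eq)
    moreover have "q < Suc w"
      using q div_le_dividend[of w "2 ^ n"] by linarith
    ultimately show "\<exists>q<Suc w. \<exists>r<2 ^ n. w = (2 * q + 1) * 2 ^ n + r"
      by (metis mod_less_divisor zero_less_numeral zero_less_power)
  next
    assume "\<exists>q<Suc w. \<exists>r<2 ^ n. w = (2 * q + 1) * 2 ^ n + r"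
    then obtain q r where "r < 2 ^ n" "w = r + (2 * q + 1) * 2 ^ n" by auto
    then have "w div 2 ^ n = 2 * q + 1"
      by (simp only: div_mult_self1) simp
    then show "n \<in> set_decode w" by (simp add: set_decode_def)
  qed
  have "decidable (\<lambda>v. v 0 \<in> set_decode (v 1))"
    unfolding * by (intro decidable_bex decidable_eq computable_add computable_mult computable_power
        computable_Suc computable_var computable_const)
  from decidable_subst[OF this, of "case_nat F (\<lambda>_. G)"] assms show ?thesis
    by (auto split: nat.split)
qed

section \<open>Semidecidable predicates\<close>

definition semidecidable :: "((nat \<Rightarrow> nat) \<Rightarrow> bool) \<Rightarrow> bool" where
  "semidecidable P \<longleftrightarrow> (\<exists>Q. decidable (\<lambda>v. Q (v 0) (\<lambda>i. v (Suc i))) \<and> (\<forall>v. P v \<longleftrightarrow> (\<exists>t. Q t v)))"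

lemma semidecidable_decidable: "decidable P \<Longrightarrow> semidecidable P"
  unfolding semidecidable_def by (rule exI[of _ "\<lambda>_. P"]) (simp add: decidable_shift)

lemma decidable_instance:
  assumes "decidable (\<lambda>v. Q (v 0) (\<lambda>i. v (Suc i)))" "computable F" "\<And>i. computable (\<sigma> i)"
  shows "decidable (\<lambda>v. Q (F v) (\<lambda>i. \<sigma> i v))"
proof -
  have "computable (case_nat F \<sigma> i)" for i
    using assms(2,3) by (cases i) auto
  from decidable_subst[OF assms(1), of "case_nat F \<sigma>", OF this] show ?thesis by simp
qed

lemma semidecidable_subst:
  assumes "semidecidable P" "\<And>i. computable (\<sigma> i)" shows "semidecidable (\<lambda>v. P (\<lambda>i. \<sigma> i v))"
proof -
  obtain Q where Q: "decidable (\<lambda>v. Q (v 0) (\<lambda>i. v (Suc i)))" "\<And>v. P v \<longleftrightarrow> (\<exists>t. Q t v)"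
    using assms(1) unfolding semidecidable_def by blast
  have "decidable (\<lambda>v. Q (v 0) (\<lambda>i. \<sigma> i (\<lambda>i. v (Suc i))))"
    by (rule decidable_instance[OF Q(1)]) (auto intro: computable_var computable_shift assms(2))
  then show ?thesis unfolding semidecidable_def
    by (intro exI[of _ "\<lambda>t v. Q t (\<lambda>i. \<sigma> i v)"]) (simp add: Q(2))
qed

lemma semidecidable_comp2:
  assumes "semidecidable (\<lambda>v. P (v 0) (v 1))" "computable F" "computable G"
  shows "semidecidable (\<lambda>v. P (F v) (G v))"
  using semidecidable_subst[OF assms(1), of "case_nat F (\<lambda>_. G)"] assms(2,3) by (simp split: nat.split)

lemma semidecidable_comp3:
  assumes "semidecidable (\<lambda>v. P (v 0) (v 1) (v 2))" "computable F" "computable G" "computable H"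
  shows "semidecidable (\<lambda>v. P (F v) (G v) (H v))"
  using semidecidable_subst[OF assms(1), of "case_nat F (case_nat G (\<lambda>_. H))"] assms(2-)
  by (simp split: nat.split add: numeral_2_eq_2)

text \<open>Both witnesses are sought below one common bound \<open>t\<close>, which spares decoding
  a pair.\<close>

lemma semidecidable_conj:
  assumes "semidecidable P" "semidecidable P'" shows "semidecidable (\<lambda>v. P v \<and> P' v)"
proof -
  obtain Q where Q: "decidable (\<lambda>v. Q (v 0) (\<lambda>i. v (Suc i)))" "\<And>v. P v \<longleftrightarrow> (\<exists>t. Q t v)"
    using assms(1) unfolding semidecidable_def by blast
  obtain Q' where Q': "decidable (\<lambda>v. Q' (v 0) (\<lambda>i. v (Suc i)))" "\<And>v. P' v \<longleftrightarrow> (\<exists>t. Q' t v)"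
    using assms(2) unfolding semidecidable_def by blast
  have "decidable (\<lambda>v. (\<exists>a<v 0. Q a (\<lambda>i. v (Suc i))) \<and> (\<exists>b<v 0. Q' b (\<lambda>i. v (Suc i))))"
    by (intro decidable_conj decidable_bex computable_var decidable_instance[OF Q(1)] decidable_instance[OF Q'(1)])
  moreover have "P v \<and> P' v \<longleftrightarrow> (\<exists>t. (\<exists>a<t. Q a v) \<and> (\<exists>b<t. Q' b v))" for v
    unfolding Q(2) Q'(2) by (metis less_Suc_eq_le max.cobounded1 max.cobounded2)
  ultimately show ?thesis unfolding semidecidable_def
    by (intro exI[of _ "\<lambda>t v. (\<exists>a<t. Q a v) \<and> (\<exists>b<t. Q' b v)"]) blast
qed

lemma semidecidable_disj:
  assumes "semidecidable P" "semidecidable P'" shows "semidecidable (\<lambda>v. P v \<or> P' v)"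
proof -
  obtain Q where Q: "decidable (\<lambda>v. Q (v 0) (\<lambda>i. v (Suc i)))" "\<And>v. P v \<longleftrightarrow> (\<exists>t. Q t v)"
    using assms(1) unfolding semidecidable_def by blast
  obtain Q' where Q': "decidable (\<lambda>v. Q' (v 0) (\<lambda>i. v (Suc i)))" "\<And>v. P' v \<longleftrightarrow> (\<exists>t. Q' t v)"
    using assms(2) unfolding semidecidable_def by blast
  show ?thesis unfolding semidecidable_def
    by (intro exI[of _ "\<lambda>t v. Q t v \<or> Q' t v"] conjI decidable_disj Q(1) Q'(1)) (auto simp: Q Q')
qed

lemma semidecidable_ex:
  assumes "semidecidable (\<lambda>v. P (v 0) (\<lambda>i. v (Suc i)))" shows "semidecidable (\<lambda>v. \<exists>k. P k v)"
proof -
  obtain Q where Q: "decidable (\<lambda>v. Q (v 0) (\<lambda>i. v (Suc i)))"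
    and P: "\<And>v. P (v 0) (\<lambda>i. v (Suc i)) \<longleftrightarrow> (\<exists>t. Q t v)"
    using assms unfolding semidecidable_def by blast
  have P': "P k v \<longleftrightarrow> (\<exists>t. Q t (case_nat k v))" for k v
    using P[of "case_nat k v"] by simp
  \<comment> \<open>Inside both binders variable 0 is \<open>k\<close>, 1 is \<open>a\<close>, 2 is
    the bound, and the outer environment starts at 3.\<close>
  have var: "computable (\<lambda>v. case i of 0 \<Rightarrow> v 0 | Suc i \<Rightarrow> v (Suc (Suc (Suc i))))" for i
    by (cases i) (simp_all add: computable_var)
  have "decidable (\<lambda>v. \<exists>a<v 0. \<exists>k<v 0. Q a (case_nat k (\<lambda>i. v (Suc i))))"
    by (intro decidable_bex computable_var decidable_instance[OF Q(1), of _ "\<lambda>i v. case_nat (v 0) (\<lambda>i. v (Suc (Suc (Suc i)))) i"])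
      (auto intro: computable_var var)
  moreover have "(\<exists>k. P k v) \<longleftrightarrow> (\<exists>t. \<exists>a<t. \<exists>k<t. Q a (case_nat k v))" for v
    unfolding P' by (metis less_Suc_eq_le max.cobounded1 max.cobounded2)
  ultimately show ?thesis unfolding semidecidable_def
    by (intro exI[of _ "\<lambda>t v. \<exists>a<t. \<exists>k<t. Q a (case_nat k v)"]) blast
qed

text \<open>Finitely many witnesses, one for each \<open>k < B v\<close>, have a common upper
  bound.\<close>

lemma semidecidable_ball:
  assumes B: "computable B" and "semidecidable (\<lambda>v. P (v 0) (\<lambda>i. v (Suc i)))"
  shows "semidecidable (\<lambda>v. \<forall>k<B v. P k v)"
proof -
  obtain Q where Q: "decidable (\<lambda>v. Q (v 0) (\<lambda>i. v (Suc i)))"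
    and P: "\<And>v. P (v 0) (\<lambda>i. v (Suc i)) \<longleftrightarrow> (\<exists>t. Q t v)"
    using assms unfolding semidecidable_def by blast
  have P': "P k v \<longleftrightarrow> (\<exists>t. Q t (case_nat k v))" for k v
    using P[of "case_nat k v"] by simp
  have var: "computable (\<lambda>v. case i of 0 \<Rightarrow> v (Suc 0) | Suc i \<Rightarrow> v (Suc (Suc (Suc i))))" for i
    by (cases i) (simp_all add: computable_var)
  have "decidable (\<lambda>v. \<forall>k<B (\<lambda>i. v (Suc i)). \<exists>a<v 0. Q a (case_nat k (\<lambda>i. v (Suc i))))"
    by (intro decidable_bex decidable_ball computable_var computable_shift[OF B] 
        decidable_instance[OF Q(1), of _ "\<lambda>i v. case_nat (v (Suc 0)) (\<lambda>i. v (Suc (Suc (Suc i)))) i"])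
      (auto intro: computable_var var)
  moreover have "(\<forall>k<b. P k v) \<longleftrightarrow> (\<exists>t. \<forall>k<b. \<exists>a<t. Q a (case_nat k v))" for v b
  proof (induction b)
    case (Suc b)
    show ?case
    proof
      assume *: "\<forall>k<Suc b. P k v"
      then obtain t where t: "\<forall>k<b. \<exists>a<t. Q a (case_nat k v)" using Suc by auto
      obtain s where s: "Q s (case_nat b v)" using * P' by blast
      show "\<exists>t. \<forall>k<Suc b. \<exists>a<t. Q a (case_nat k v)"
        using t s by (intro exI[of _ "max t (Suc s)"]) (metis less_Suc_eq lessI less_max_iff_disj)
    qed (use P' in blast)
  qed auto
  ultimately show ?thesis unfolding semidecidable_def
    by (intro exI[of _ "\<lambda>t v. \<forall>k<B v. \<exists>a<t. Q a (case_nat k v)"]) blast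
qed

lemmas semidecidable_eq = semidecidable_decidable[OF decidable_eq]
lemmas semidecidable_neq = semidecidable_decidable[OF decidable_not[OF decidable_eq]]
lemmas semidecidable_less = semidecidable_decidable[OF decidable_less]
lemmas semidecidable_le = semidecidable_decidable[OF decidable_le]
lemmas semidecidable_set_decode = semidecidable_decidable[OF decidable_set_decode]
lemmas semidecidable_not_set_decode = semidecidable_decidable[OF decidable_not[OF decidable_set_decode]]

lemmas computable_intros = computable_var computable_Suc computable_const computable_add computable_mult
  computable_power computable_prod_encode

lemmas semidecidable_intros = semidecidable_eq semidecidable_neq semidecidable_less semidecidable_le
  semidecidable_conj semidecidable_disj semidecidable_ex semidecidable_ball

section \<open>From semidecidable predicates to computable functions\<close>

text \<open>\<open>computable\<close> speaks only about long environments, so the argument list is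
  filled up with copies of the second argument.\<close>

lemma eval_binary:
  assumes "computable (\<lambda>v. f (v 0) (v 1))"
  obtains r where "\<And>a b y. eval r [a, b] y \<longleftrightarrow> y = f a b"
proof -
  obtain r N where r: "\<And>n v y. n \<ge> N \<Longrightarrow> eval r (map v [0..<n]) y \<longleftrightarrow> y = f (v 0) (v 1)"
    using assms unfolding computable_def by blast
  have "eval (Cn r (map (case_nat (Id 0) (\<lambda>_. Id 1)) [0..<Suc N])) [a, b] y \<longleftrightarrow> y = f a b" for a b y
    using r[of "Suc N" "case_nat a (\<lambda>_. b)" y]
    by (subst eval_Cn_functional[where G = "case_nat a (\<lambda>_. b)"])
      (simp_all add: eval_Id_iff del: upt_Suc split: nat.split)
  then show ?thesis using that by blast
qed

text \<open>Dovetailing: \<open>Mn\<close> searches for the first stage \<open>s\<close> that bounds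
  some value \<open>y\<close> and its witness \<open>t\<close>; the least such \<open>y\<close> at
  that stage is the output. Only the search for \<open>s\<close> can diverge.\<close>

lemma semidecidable_selection:
  assumes "semidecidable (\<lambda>v. P (v 0) (v 1))"
  obtains f where "partial_computable f" "\<And>n. f n \<noteq> None \<longleftrightarrow> (\<exists>y. P n y)" "\<And>n y. f n = Some y \<Longrightarrow> P n y"
proof -
  obtain Q where Q: "decidable (\<lambda>v. Q (v 0) (\<lambda>i. v (Suc i)))"
    and P: "\<And>v. P (v 0) (v 1) \<longleftrightarrow> (\<exists>t. Q t v)"
    using assms unfolding semidecidable_def by blast
  define q where "q t n y \<longleftrightarrow> Q t (case_nat n (\<lambda>_. y))" for t n y
  have P': "P n y \<longleftrightarrow> (\<exists>t. q t n y)" for n y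
    using P[of "case_nat n (\<lambda>_. y)"] by (simp add: q_def)
  have q: "decidable (\<lambda>v. q (F v) (G v) (H v))"
    if "computable F" "computable G" "computable H" for F G H
  proof -
    have "computable (\<lambda>v. case_nat (G v) (\<lambda>_. H v) i)" for i
      using that by (cases i) auto
    from decidable_instance[OF Q that(1), of "\<lambda>i v. case_nat (G v) (\<lambda>_. H v) i", OF this]
    show ?thesis unfolding q_def .
  qed
  define S where "S s n \<longleftrightarrow> (\<exists>y<s. \<exists>t<s. q t n y)" for s n
  \<comment> \<open>The disjunct \<open>s \<le> y\<close> makes the minimum exist for all arguments,
    also where \<open>S s n\<close> fails.\<close>
  define out where "out s n = (LEAST y. s \<le> y \<or> (\<exists>t<s. q t n y))" for s n
  have "computable (\<lambda>v. if S (v 0) (v 1) then 0 else 1)"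
    unfolding S_def decidable_def[symmetric] by (intro decidable_bex q computable_intros)
  then obtain r1 where "\<And>s n y. eval r1 [s, n] y \<longleftrightarrow> y = (if S s n then 0 else 1)"
    using eval_binary[of "\<lambda>s n. if S s n then 0 else 1"] by blast
  then have r1: "eval (Mn r1) [n] s \<longleftrightarrow> S s n \<and> (\<forall>k<s. \<not> S k n)" for n s
    by (auto simp: eval_Mn_iff)
  have "computable (\<lambda>v. out (v 0) (v 1))"
    unfolding out_def by (intro computable_LEAST decidable_disj decidable_bex decidable_le q computable_intros) auto
  then obtain r2 where r2: "\<And>s n y. eval r2 [s, n] y \<longleftrightarrow> y = out s n"
    using eval_binary[of out] by blast
  define f where "f n = (if \<exists>s. S s n then Some (out (LEAST s. S s n) n) else None)" for n
  have "eval (Cn r2 [Mn r1, Id 0]) [n] y \<longleftrightarrow> (\<exists>s. eval (Mn r1) [n] s \<and> y = out s n)" for n y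
    by (auto simp: eval_Cn_iff list_all2_Cons1 eval_Id_iff r2)
  moreover have "eval (Mn r1) [n] s \<longleftrightarrow> (\<exists>s. S s n) \<and> s = (LEAST s. S s n)" for n s
    unfolding r1 by (metis LeastI_ex linorder_neqE_nat not_less_Least)
  ultimately have "eval (Cn r2 [Mn r1, Id 0]) [n] y \<longleftrightarrow> f n = Some y" for n y
    by (auto simp: f_def)
  then have "partial_computable f"
    unfolding partial_computable_def by blast
  moreover have "f n \<noteq> None \<longleftrightarrow> (\<exists>y. P n y)" for n
  proof -
    have "(\<exists>s. S s n) \<longleftrightarrow> (\<exists>y. P n y)"
      unfolding S_def P' by (metis less_Suc_eq_le max.cobounded1 max.cobounded2)
    then show ?thesis by (simp add: f_def)
  qed
  moreover have "P n y" if Some: "f n = Some y" for n y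
  proof -
    obtain s where s: "S s n" "y = out s n"
      using Some unfolding f_def by (metis LeastI_ex option.distinct(1) option.inject)
    then obtain y' where y': "y' < s" "\<exists>t<s. q t n y'" by (auto simp: S_def)
    \<comment> \<open>The minimum is at most the genuine candidate \<open>y' < s\<close>, which
      excludes the default case \<open>s \<le> y\<close>.\<close>
    have "y \<le> y'"
      unfolding s(2) out_def using y'(2) by (auto intro: Least_le)
    moreover have "s \<le> y \<or> (\<exists>t<s. q t n y)"
      unfolding s(2) out_def by (rule LeastI[of "\<lambda>y. s \<le> y \<or> (\<exists>t<s. q t n y)" s]) simp
    ultimately show ?thesis using y'(1) P' by auto
  qed
  ultimately show ?thesis using that by blast
qed

lemma total_computable_selection:
  assumes "semidecidable (\<lambda>v. P (v 0) (v 1))" "\<And>n. \<exists>y. P n y"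
  obtains f where "total_computable f" "\<And>n. P n (f n)"
proof -
  obtain f where f: "partial_computable f" "\<And>n. f n \<noteq> None \<longleftrightarrow> (\<exists>y. P n y)"
      "\<And>n y. f n = Some y \<Longrightarrow> P n y"
    using semidecidable_selection[OF assms(1)] by blast
  have "f = (\<lambda>n. Some (the (f n)))"
    using f(2) assms(2) by auto
  then have "total_computable (\<lambda>n. the (f n))"
    using f(1) unfolding total_computable_def by simp
  moreover have "P n (the (f n))" for n
    using f(2,3) assms(2) by (metis option.collapse)
  ultimately show ?thesis using that by blast
qed

lemma enumerable_semidecidable:
  assumes "semidecidable (\<lambda>v. v 0 \<in> G)" shows "enumerable G"
proof -
  obtain f where "partial_computable f" "\<And>n. f n \<noteq> None \<longleftrightarrow> (\<exists>y::nat. n \<in> G)"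
    by (rule semidecidable_selection[of "\<lambda>n y. n \<in> G"]) (use assms in auto)
  then show ?thesis unfolding enumerable_def by auto
qed

lemma computable_total_computable:
  assumes "total_computable h" "computable F" shows "computable (\<lambda>v. h (F v))"
proof -
  obtain r where r: "\<And>n y. eval r [n] y \<longleftrightarrow> y = h n"
    using assms(1) unfolding total_computable_def partial_computable_def by (metis option.inject)
  have "computable (\<lambda>v. h (v 0))"
    unfolding computable_def
    by (intro exI[of _ "Cn r [Id 0]"] exI[of _ 1])
      (auto simp: eval_Cn_iff list_all2_Cons1 eval_Id_iff r)
  from computable_comp1[OF this assms(2)] show ?thesis .
qed

section \<open>Derivations and their certificates\<close>

text \<open>Common format for the recursive definitions below: evaluation of programs, the counter,
  and the chains of the Schroeder--Bernstein argument. For a rule with one premise, \<open>p\<close>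
  can serve in both places.\<close>

inductive derivable :: "(nat \<Rightarrow> bool) \<Rightarrow> (nat \<Rightarrow> nat \<Rightarrow> nat \<Rightarrow> bool) \<Rightarrow> nat \<Rightarrow> bool" for A R where
  derivable_axiom: "A c \<Longrightarrow> derivable A R c"
| derivable_rule: "derivable A R p \<Longrightarrow> derivable A R q \<Longrightarrow> R p q c \<Longrightarrow> derivable A R c"

text \<open>A derivation is certified by a finite set of pairs (rank, judgement), coded as a bit set, in
  which every judgement is an axiom or follows from two judgements of smaller rank.\<close>

definition justified :: "(nat \<Rightarrow> bool) \<Rightarrow> (nat \<Rightarrow> nat \<Rightarrow> nat \<Rightarrow> bool) \<Rightarrow> nat set \<Rightarrow> nat \<Rightarrow> nat \<Rightarrow> bool" where
  "justified A R D m c \<longleftrightarrow> A c \<or> (\<exists>a b p q. a < m \<and> b < m \<and>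
     prod_encode (a, p) \<in> D \<and> prod_encode (b, q) \<in> D \<and> R p q c)"

definition certificate :: "(nat \<Rightarrow> bool) \<Rightarrow> (nat \<Rightarrow> nat \<Rightarrow> nat \<Rightarrow> bool) \<Rightarrow> nat set \<Rightarrow> bool" where
  "certificate A R D \<longleftrightarrow> (\<forall>m c. prod_encode (m, c) \<in> D \<longrightarrow> justified A R D m c)"

lemma justified_mono: "justified A R D m c \<Longrightarrow> D \<subseteq> D' \<Longrightarrow> justified A R D' m c"
  unfolding justified_def by (meson subsetD)

text \<open>Ranks strictly decrease from conclusion to premises, so judgements cannot justify each
  other in a circle.\<close>

lemma certificate_sound:
  assumes "certificate A R D" "prod_encode (m, c) \<in> D" shows "derivable A R c"
  using assms(2)
proof (induction m arbitrary: c rule: less_induct)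
  case (less m)
  from assms(1) less.prems have "justified A R D m c"
    unfolding certificate_def by blast
  then show ?case using less.IH unfolding justified_def by (blast intro: derivable.intros)
qed

lemma certificate_complete:
  assumes "derivable A R c"
  shows "\<exists>D m. finite D \<and> certificate A R D \<and> prod_encode (m, c) \<in> D"
  using assms
proof induction
  case (derivable_axiom c)
  then show ?case
    by (intro exI[of _ "{prod_encode (0, c)}"] exI[of _ 0]) (auto simp: certificate_def justified_def)
next
  case (derivable_rule p q c)
  obtain D a where D: "finite D" "certificate A R D" "prod_encode (a, p) \<in> D"
    using derivable_rule.IH(1) by blast
  obtain D' b where D': "finite D'" "certificate A R D'" "prod_encode (b, q) \<in> D'"
    using derivable_rule.IH(2) by blast
  \<comment> \<open>The new judgement gets a rank above those of both premises; the merged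
    certificates stay valid because justification is monotone.\<close>
  define k where "k = prod_encode (Suc (max a b), c)"
  have "certificate A R (insert k (D \<union> D'))"
    unfolding certificate_def
  proof (intro allI impI)
    fix m e assume "prod_encode (m, e) \<in> insert k (D \<union> D')"
    then consider "m = Suc (max a b)" "e = c" | "prod_encode (m, e) \<in> D" | "prod_encode (m, e) \<in> D'"
      unfolding k_def by auto
    then show "justified A R (insert k (D \<union> D')) m e"
    proof cases
      case 1
      have "a < m" "b < m" using 1 by auto
      then show ?thesis
        unfolding justified_def 1(2) using D(3) D'(3) derivable_rule.hyps(3) by blast
    next
      case 2
      with D(2) have "justified A R D m e" unfolding certificate_def by blast
      then show ?thesis by (rule justified_mono) blast
    next
      case 3
      with D'(2) have "justified A R D' m e" unfolding certificate_def by blast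
      then show ?thesis by (rule justified_mono) blast
    qed
  qed
  then show ?case using D(1) D'(1) k_def by (meson finite_Un finite_insert insertI1)
qed

lemma semidecidable_derivable:
  assumes A: "semidecidable (\<lambda>v. A (v 0))" and R: "semidecidable (\<lambda>v. R (v 0) (v 1) (v 2))"
    and F: "computable F"
  shows "semidecidable (\<lambda>v. derivable A R (F v))"
proof -
  have A': "semidecidable (\<lambda>v. A (G v))" if "computable G" for G
    using semidecidable_comp2[of "\<lambda>a b. A a", OF A that that] .
  note R' = semidecidable_comp3[OF R]
  \<comment> \<open>Set bits of \<open>w\<close> sit at positions below \<open>w\<close>, so a
    quantifier bounded by \<open>w\<close> covers the whole coded set.\<close>
  have less_code: "j < w" if "j \<in> set_decode w" for j w
  proof -
    have "w div 2 ^ j \<noteq> 0"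
      using that unfolding set_decode_def by (intro notI) simp
    then have "2 ^ j \<le> w" by (metis div_less not_le)
    then show ?thesis using less_exp[of j] by linarith
  qed
  have *: "derivable A R c \<longleftrightarrow> (\<exists>w m. prod_encode (m, c) \<in> set_decode w \<and>
     (\<forall>j<w. j \<notin> set_decode w \<or> (\<exists>m c. j = prod_encode (m, c) \<and> justified A R (set_decode w) m c)))" for c
  proof -
    have "(\<forall>j<w. j \<notin> set_decode w \<or> (\<exists>m c. j = prod_encode (m, c) \<and> justified A R (set_decode w) m c))
      \<longleftrightarrow> certificate A R (set_decode w)" for w
      unfolding certificate_def by (metis less_code prod_decode_inverse prod_encode_eq surj_pair Pair_inject)
    then show ?thesis
      using certificate_sound certificate_complete[of A R c] by (metis set_encode_inverse)
  qed
  have "semidecidable (\<lambda>v. derivable A R (v 0))"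
    unfolding * justified_def by (intro semidecidable_intros A' R' semidecidable_set_decode
        semidecidable_not_set_decode computable_intros)
  from semidecidable_comp2[of "\<lambda>a b. derivable A R a", OF this F F] show ?thesis .
qed

section \<open>A universal semidecidable relation\<close>

fun code :: "recf \<Rightarrow> nat" where
  "code Z = prod_encode (0, 0)"
| "code S = prod_encode (1, 0)"
| "code (Id i) = prod_encode (2, i)"
| "code (Cn f gs) = prod_encode (3, prod_encode (code f, list_encode (map code gs)))"
| "code (Pr f g) = prod_encode (4, prod_encode (code f, code g))"
| "code (Mn f) = prod_encode (5, code f)"

text \<open>Judgements are \<open>judgement a X y\<close> with \<open>X\<close> coding the argument list. Besides codes of functions,
  \<open>a\<close> may be a pair \<open>(6, G)\<close>, for the pointwise evaluation of a list \<open>G\<close> of functions to the list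
  coded by \<open>y\<close>, or a pair \<open>(7, f)\<close>, stating that \<open>f\<close> has positive values at all \<open>k < y\<close> followed by \<open>X\<close>.\<close>

definition judgement :: "nat \<Rightarrow> nat \<Rightarrow> nat \<Rightarrow> nat" where
  "judgement a X y = prod_encode (a, prod_encode (X, y))"

lemma judgement_eq [simp]: "judgement a X y = judgement a' X' y' \<longleftrightarrow> a = a' \<and> X = X' \<and> y = y'"
  by (simp add: judgement_def)

text \<open>The form of \<open>list_encode\<close> on a nonempty list; the empty list has code
  0.\<close>

abbreviation cons :: "nat \<Rightarrow> nat \<Rightarrow> nat" where
  "cons x X \<equiv> Suc (prod_encode (x, X))"

lemma list_encode_eq_iff:
  "list_encode xs = 0 \<longleftrightarrow> xs = []"
  "list_encode xs = cons x X \<longleftrightarrow> (\<exists>ys. xs = x # ys \<and> X = list_encode ys)"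
  by (cases xs; auto)+

lemma eq_list_encode_iff:
  "0 = list_encode xs \<longleftrightarrow> xs = []"
  "cons x X = list_encode xs \<longleftrightarrow> (\<exists>ys. xs = x # ys \<and> X = list_encode ys)"
  by (cases xs; auto)+

text \<open>In order: \<open>Z\<close>, \<open>S\<close>, \<open>Id 0\<close>, the empty list of
  functions, and the empty range of positivity checks.\<close>

definition eval_axiom :: "nat \<Rightarrow> bool" where
  "eval_axiom c \<longleftrightarrow>
     (\<exists>X. c = judgement (prod_encode (0, 0)) X 0) \<or>
     (\<exists>x X. c = judgement (prod_encode (1, 0)) (cons x X) (Suc x)) \<or>
     (\<exists>x X. c = judgement (prod_encode (2, 0)) (cons x X) x) \<or>
     (\<exists>X. c = judgement (prod_encode (6, 0)) X 0) \<or>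
     (\<exists>f X. c = judgement (prod_encode (7, f)) X 0)"

text \<open>Projections drop the head of the argument list, and the conditions of \<open>Cn\<close>
  and \<open>Mn\<close> on lists and initial segments are unrolled one entry at a time, so that two
  premises suffice.\<close>

definition eval_rule :: "nat \<Rightarrow> nat \<Rightarrow> nat \<Rightarrow> bool" where
  "eval_rule p q c \<longleftrightarrow>
     (\<exists>i x X y. p = judgement (prod_encode (2, i)) X y \<and>
        c = judgement (prod_encode (2, Suc i)) (cons x X) y) \<or>
     (\<exists>f G X Y y. p = judgement (prod_encode (6, G)) X Y \<and> q = judgement f Y y \<and>
        c = judgement (prod_encode (3, prod_encode (f, G))) X y) \<or>
     (\<exists>g G X y Y. p = judgement g X y \<and> q = judgement (prod_encode (6, G)) X Y \<and>
        c = judgement (prod_encode (6, cons g G)) X (cons y Y)) \<or>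
     (\<exists>f g X y. p = judgement f X y \<and>
        c = judgement (prod_encode (4, prod_encode (f, g))) (cons 0 X) y) \<or>
     (\<exists>f g n X z y. p = judgement (prod_encode (4, prod_encode (f, g))) (cons n X) z \<and>
        q = judgement g (cons z (cons n X)) y \<and>
        c = judgement (prod_encode (4, prod_encode (f, g))) (cons (Suc n) X) y) \<or>
     (\<exists>f X y. p = judgement (prod_encode (7, f)) X y \<and> q = judgement f (cons y X) 0 \<and>
        c = judgement (prod_encode (5, f)) X y) \<or>
     (\<exists>f X y z. p = judgement (prod_encode (7, f)) X y \<and> q = judgement f (cons y X) (Suc z) \<and>
        c = judgement (prod_encode (7, f)) X (Suc y))"

definition universal :: "nat \<Rightarrow> nat \<Rightarrow> nat \<Rightarrow> bool" where
  "universal e n y \<longleftrightarrow> derivable eval_axiom eval_rule (judgement e (list_encode [n]) y)"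

lemma semidecidable_universal:
  assumes "computable F" "computable G" "computable H"
  shows "semidecidable (\<lambda>v. universal (F v) (G v) (H v))"
proof -
  have "semidecidable (\<lambda>v. eval_axiom (v 0))"
    unfolding eval_axiom_def judgement_def by (intro semidecidable_intros computable_intros)
  moreover have "semidecidable (\<lambda>v. eval_rule (v 0) (v 1) (v 2))"
    unfolding eval_rule_def judgement_def by (intro semidecidable_intros computable_intros)
  ultimately show ?thesis
    unfolding universal_def judgement_def list_encode.simps
    by (intro semidecidable_derivable computable_intros assms)
qed

lemma derivable_eval:
  "eval r xs y \<Longrightarrow> derivable eval_axiom eval_rule (judgement (code r) (list_encode xs) y)"
proof (induction rule: eval.induct)
  case (eval_Z xs)
  then show ?case by (intro derivable_axiom) (auto simp: eval_axiom_def)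
next
  case (eval_S x xs)
  then show ?case
    by (intro derivable_axiom) (auto simp: eval_axiom_def)
next
  case (eval_Id i xs)
  then show ?case
  proof (induction i arbitrary: xs)
    case 0
    then obtain x zs where xs: "xs = x # zs" by (cases xs) auto
    show ?case
      unfolding xs by (intro derivable_axiom) (auto simp: eval_axiom_def)
  next
    case (Suc i)
    then obtain x zs where xs: "xs = x # zs" by (cases xs) auto
    with Suc have "derivable eval_axiom eval_rule (judgement (code (Id i)) (list_encode zs) (zs ! i))"
      by simp
    moreover have "eval_rule (judgement (code (Id i)) (list_encode zs) (zs ! i)) q
        (judgement (code (Id (Suc i))) (list_encode xs) (xs ! Suc i))" for q
      by (simp add: eval_rule_def xs)
    ultimately show ?case by (blast intro: derivable_rule)
  qed
next
  case (eval_Cn xs gs ys f y)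
  from eval_Cn.IH(1) have "derivable eval_axiom eval_rule
    (judgement (prod_encode (6, list_encode (map code gs))) (list_encode xs) (list_encode ys))"
  proof (induction rule: list_all2_induct)
    case Nil
    then show ?case by (intro derivable_axiom) (auto simp: eval_axiom_def)
  next
    case (Cons g gs y ys)
    then have g: "derivable eval_axiom eval_rule (judgement (code g) (list_encode xs) y)" by simp
    show ?case
      by (rule derivable_rule[OF g Cons(3)]) (simp add: eval_rule_def)
  qed
  note gs = this
  show ?case
    by (rule derivable_rule[OF gs eval_Cn.IH(2)]) (simp add: eval_rule_def)
next
  case (eval_Pr0 f xs y g)
  show ?case
    by (rule derivable_rule[OF eval_Pr0.IH eval_Pr0.IH]) (simp add: eval_rule_def)
next
  case (eval_PrS f g n xs z y)
  show ?case
    by (rule derivable_rule[OF eval_PrS.IH]) (simp add: eval_rule_def)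
next
  case (eval_Mn f y xs)
  \<comment> \<open>The range of positivity checks is extended from 0 up to
    \<open>y\<close>.\<close>
  have "derivable eval_axiom eval_rule (judgement (prod_encode (7, code f)) (list_encode xs) k)"
    if "k \<le> y" for k
    using that
  proof (induction k)
    case 0
    show ?case by (intro derivable_axiom) (auto simp: eval_axiom_def)
  next
    case (Suc k)
    then obtain z where z: "derivable eval_axiom eval_rule (judgement (code f) (list_encode (k # xs)) (Suc z))"
      using eval_Mn.IH(2) by (meson Suc_le_eq)
    have k: "derivable eval_axiom eval_rule (judgement (prod_encode (7, code f)) (list_encode xs) k)"
      using Suc by simp
    show ?case
      by (rule derivable_rule[OF k z]) (simp add: eval_rule_def)
  qed
  note y = this[OF order_refl]
  show ?case
    by (rule derivable_rule[OF y eval_Mn.IH(1)]) (simp add: eval_rule_def)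
qed

section \<open>Soundness of the evaluation derivations\<close>

text \<open>The induction invariant, one clause for each kind of judgement. Numbers that code no
  program may occur in derivations and carry no obligation.\<close>

definition sound :: "nat \<Rightarrow> bool" where
  "sound c \<longleftrightarrow>
     (\<forall>r xs y. c = judgement (code r) (list_encode xs) y \<longrightarrow> eval r xs y) \<and>
     (\<forall>gs xs Y. c = judgement (prod_encode (6, list_encode (map code gs))) (list_encode xs) Y \<longrightarrow>
        (\<exists>ys. Y = list_encode ys \<and> list_all2 (\<lambda>g y. eval g xs y) gs ys)) \<and>
     (\<forall>f xs y. c = judgement (prod_encode (7, code f)) (list_encode xs) y \<longrightarrow>
        (\<forall>k<y. \<exists>z. eval f (k # xs) (Suc z)))"

text \<open>Inverts \<open>code\<close> by its tag; tags 6 and 7 belong to no program, so the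
  clauses of \<open>sound\<close> do not overlap.\<close>

lemma pair_eq_code_iff:
  "prod_encode (t, a) = code r \<longleftrightarrow>
     (r = Z \<and> t = 0 \<and> a = 0) \<or> (r = S \<and> t = 1 \<and> a = 0) \<or> (r = Id a \<and> t = 2) \<or>
     (\<exists>f gs. r = Cn f gs \<and> t = 3 \<and> a = prod_encode (code f, list_encode (map code gs))) \<or>
     (\<exists>f g. r = Pr f g \<and> t = 4 \<and> a = prod_encode (code f, code g)) \<or>
     (\<exists>f. r = Mn f \<and> t = 5 \<and> a = code f)"
  by (cases r) auto

lemmas sound_simps = sound_def pair_eq_code_iff list_encode_eq_iff eq_list_encode_iff

lemma sound_eval: "sound (judgement (code r) (list_encode xs) y) \<Longrightarrow> eval r xs y"
  unfolding sound_def by blast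

lemma sound_list:
  "sound (judgement (prod_encode (6, list_encode (map code gs))) (list_encode xs) Y) \<Longrightarrow>
     \<exists>ys. Y = list_encode ys \<and> list_all2 (\<lambda>g y. eval g xs y) gs ys"
  unfolding sound_def by blast

lemma sound_positive:
  "sound (judgement (prod_encode (7, code f)) (list_encode xs) y) \<Longrightarrow> k < y \<Longrightarrow>
     \<exists>z. eval f (k # xs) (Suc z)"
  unfolding sound_def by blast

lemma sound_axiom:
  assumes "eval_axiom c" shows "sound c"
proof -
  have "eval (Id 0) (x # xs) x" for x xs
    using eval_Id[of 0 "x # xs"] by simp
  then show ?thesis
    using assms unfolding eval_axiom_def
    by (elim disjE exE; hypsubst) (auto simp: sound_simps intro!: eval.intros exI[of _ "[]"])
qed

lemma sound_rule:
  assumes "sound p" "sound q" "eval_rule p q c" shows "sound c"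
  using assms(3) unfolding eval_rule_def
proof (elim disjE exE conjE; hypsubst)
  fix i x X y
  assume "p = judgement (prod_encode (2, i)) X y"
  with assms(1) have "eval (Id (Suc i)) (x # xs) y" if "X = list_encode xs" for xs
    using that sound_eval[of "Id i" xs y] by (auto simp: eval_Id_iff)
  then show "sound (judgement (prod_encode (2, Suc i)) (cons x X) y)"
    by (auto simp: sound_simps)
next
  fix f G X Y y
  assume "p = judgement (prod_encode (6, G)) X Y" "q = judgement f Y y"
  with assms(1,2) have "eval (Cn f' gs) xs y"
    if "G = list_encode (map code gs)" "X = list_encode xs" "f = code f'" for f' gs xs
    using that sound_list[of gs xs Y] sound_eval[of f' _ y] by (auto intro: eval_Cn)
  then show "sound (judgement (prod_encode (3, prod_encode (f, G))) X y)"
    by (auto simp: sound_simps)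
next
  fix g G X y Y
  assume "p = judgement g X y" "q = judgement (prod_encode (6, G)) X Y"
  with assms(1,2) have "\<exists>ys. Y = list_encode ys \<and> list_all2 (\<lambda>g y. eval g xs y) (g' # gs) (y # ys)"
    if "G = list_encode (map code gs)" "X = list_encode xs" "g = code g'" for g' gs xs
    using that sound_eval[of g' xs y] sound_list[of gs xs Y] by auto
  then show "sound (judgement (prod_encode (6, cons g G)) X (cons y Y))"
    by (fastforce simp: sound_simps map_eq_Cons_conv Cons_eq_map_conv)
next
  fix f g X y
  assume "p = judgement f X y"
  with assms(1) have "eval (Pr f' g') (0 # xs) y" if "f = code f'" "X = list_encode xs" for f' g' xs
    using that sound_eval[of f' xs y] by (auto intro: eval_Pr0)
  then show "sound (judgement (prod_encode (4, prod_encode (f, g))) (cons 0 X) y)"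
    by (auto simp: sound_simps)
next
  fix f g n X z y
  assume "p = judgement (prod_encode (4, prod_encode (f, g))) (cons n X) z"
    "q = judgement g (cons z (cons n X)) y"
  with assms(1,2) have "eval (Pr f' g') (Suc n # xs) y"
    if "f = code f'" "g = code g'" "X = list_encode xs" for f' g' xs
    using that sound_eval[of "Pr f' g'" "n # xs" z] sound_eval[of g' "z # n # xs" y]
    by (auto intro: eval_PrS)
  then show "sound (judgement (prod_encode (4, prod_encode (f, g))) (cons (Suc n) X) y)"
    by (auto simp: sound_simps)
next
  fix f X y
  assume "p = judgement (prod_encode (7, f)) X y" "q = judgement f (cons y X) 0"
  with assms(1,2) have "eval (Mn f') xs y" if "f = code f'" "X = list_encode xs" for f' xs
    using that sound_positive[of f' xs y] sound_eval[of f' "y # xs" 0] by (auto intro: eval_Mn)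
  then show "sound (judgement (prod_encode (5, f)) X y)"
    by (auto simp: sound_simps)
next
  fix f X y z
  assume "p = judgement (prod_encode (7, f)) X y" "q = judgement f (cons y X) (Suc z)"
  with assms(1,2) have "\<exists>z. eval f' (k # xs) (Suc z)"
    if "f = code f'" "X = list_encode xs" "k < Suc y" for f' xs k
    using that sound_positive[of f' xs y k] sound_eval[of f' "y # xs" "Suc z"]
    by (auto simp: less_Suc_eq)
  then show "sound (judgement (prod_encode (7, f)) X (Suc y))"
    by (auto simp: sound_simps)
qed

lemma universal_code_iff: "universal (code r) n y \<longleftrightarrow> eval r [n] y"
proof
  assume "universal (code r) n y"
  then have "derivable eval_axiom eval_rule (judgement (code r) (list_encode [n]) y)"
    by (simp add: universal_def)
  then have "sound (judgement (code r) (list_encode [n]) y)"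
    by induction (auto intro: sound_axiom sound_rule)
  then show "eval r [n] y" unfolding sound_def by blast
qed (unfold universal_def, rule derivable_eval)

section \<open>Injective increasing reductions\<close>

text \<open>The maximum in \<open>blen\<close> exists because \<open>2 ^ k\<close> exceeds
  \<open>k\<close>; the length estimates rest on this equivalence.\<close>

lemma power_le_iff_blen: "2 ^ k \<le> n + 1 \<longleftrightarrow> k \<le> blen n"
proof
  have bound: "k \<le> n + 1" if "2 ^ k \<le> n + 1" for k
    using that less_exp[of k] by linarith
  show "k \<le> blen n" if "2 ^ k \<le> n + 1"
    unfolding blen_def by (rule Greatest_le_nat[where b = "n + 1"]) (use that bound in auto)
  have "2 ^ blen n \<le> n + 1"
    unfolding blen_def by (rule GreatestI_nat[where k = 0 and b = "n + 1"]) (use bound in auto)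
  then show "2 ^ k \<le> n + 1" if "k \<le> blen n"
    using that power_increasing[of k "blen n" "2::nat"] by linarith
qed

lemma blen_mono: "m \<le> n \<Longrightarrow> blen m \<le> blen n"
  by (meson add_le_mono1 le_trans order_refl power_le_iff_blen)

lemma blen_mult_power: "blen (2 ^ c * (x + 1)) \<le> blen x + (c + 1)"
proof -
  let ?k = "blen (2 ^ c * (x + 1))"
  \<comment> \<open>For \<open>?k < c + 1\<close> truncated subtraction makes the left side 1.
    Otherwise \<open>2 ^ (c + 1)\<close> is cancelled; the additional factor 2 absorbs the summand 1
    in the definition of \<open>blen\<close>.\<close>
  have "2 ^ (?k - (c + 1)) \<le> x + 1"
  proof (cases "c + 1 \<le> ?k")
    case True
    have "2 ^ (c + 1) * 2 ^ (?k - (c + 1)) = (2::nat) ^ ?k"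
      using True by (simp only: flip: power_add) simp
    also have "\<dots> \<le> 2 ^ c * (x + 1) + 1"
      using power_le_iff_blen by blast
    also have "\<dots> \<le> 2 ^ (c + 1) * (x + 1)"
      by (simp add: Suc_le_eq)
    finally show ?thesis by (simp only: mult_le_cancel1) simp
  qed simp
  then show ?thesis by (simp only: power_le_iff_blen le_diff_conv)
qed

text \<open>For fixed \<open>e\<close> this pairing is linear in \<open>z\<close>, hence length-bounded, unlike \<open>prod_encode\<close>.\<close>

definition idx :: "nat \<Rightarrow> nat \<Rightarrow> nat" where
  "idx e z = 2 ^ e * (2 * z + 1)"

text \<open>Uniqueness of the factorisation into a power of two and an odd number: the induction
  strips a factor 2, parity settles the remaining cases.\<close>

lemma idx_eq_iff: "idx e z = idx e' z' \<longleftrightarrow> e = e' \<and> z = z'"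
proof (induction e arbitrary: e')
  case 0
  show ?case by (cases e') (auto simp: idx_def, presburger+)
next
  case (Suc e)
  show ?case
  proof (cases e')
    case 0
    then show ?thesis by (auto simp: idx_def) presburger
  next
    case (Suc d)
    have "idx (Suc a) b = 2 * idx a b" for a b
      by (simp add: idx_def)
    then show ?thesis using Suc.IH[of d] Suc by simp
  qed
qed

lemma computable_idx: "computable F \<Longrightarrow> computable G \<Longrightarrow> computable (\<lambda>v. idx (F v) (G v))"
  unfolding idx_def by (intro computable_intros)

section \<open>The counter\<close>

primrec count :: "(nat \<Rightarrow> nat) \<Rightarrow> nat \<Rightarrow> nat" where
  "count g 0 = 0"
| "count g (Suc z) = (if count g z < g z then Suc (count g z) else count g z)"

text \<open>If the counter never left \<open>x\<close>, the first \<open>2 * x + 2\<close> steps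
  would contain at most \<open>x\<close> advances. Every other step has an image \<le>
  \<open>x\<close>, so injectivity allows at most \<open>x + 1\<close> of them: one step too
  few.\<close>

lemma exists_count_less:
  assumes "inj g"
  shows "\<exists>z<2 * x + 2. count g z = x \<and> x < g z"
proof (rule ccontr)
  assume *: "\<not> (\<exists>z<2 * x + 2. count g z = x \<and> x < g z)"
  have le: "count g z \<le> x" if "z \<le> 2 * x + 2" for z
    using that
  proof (induction z)
    case (Suc z)
    then show ?case using * by (cases "count g z = x") auto
  qed simp
  have sum: "z = count g z + card {y. y < z \<and> g y \<le> count g y}" for z
  proof (induction z)
    case (Suc z)
    have "{y. y < Suc z \<and> g y \<le> count g y} =
        (if g z \<le> count g z then insert z else id) {y. y < z \<and> g y \<le> count g y}"
      by (auto simp: less_Suc_eq)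
    then show ?case using Suc by auto
  qed simp
  have "card {y. y < 2 * x + 2 \<and> g y \<le> count g y} \<le> card {..x}"
    using assms by (intro card_inj_on_le[of g]) (auto intro: inj_on_subset order_trans[OF _ le])
  then show False using sum[of "2 * x + 2"] le[of "2 * x + 2"] by simp
qed

definition count_axiom :: "nat \<Rightarrow> bool" where
  "count_axiom c \<longleftrightarrow> (\<exists>e. c = judgement e 0 0)"

definition count_rule :: "nat \<Rightarrow> nat \<Rightarrow> nat \<Rightarrow> bool" where
  "count_rule p q c \<longleftrightarrow> (\<exists>e z k v. p = judgement e z k \<and> universal e (idx e z) v \<and>
     ((k < v \<and> c = judgement e (Suc z) (Suc k)) \<or> (v \<le> k \<and> c = judgement e (Suc z) k)))"

text \<open>A relational form of \<open>count\<close>, since \<open>e\<close> ranges over all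
  numbers: where \<open>e\<close> yields no value, the derivation cannot continue.\<close>

definition universal_count :: "nat \<Rightarrow> nat \<Rightarrow> nat \<Rightarrow> bool" where
  "universal_count e z k \<longleftrightarrow> derivable count_axiom count_rule (judgement e z k)"

lemma semidecidable_universal_count:
  assumes "computable F" "computable G" "computable H"
  shows "semidecidable (\<lambda>v. universal_count (F v) (G v) (H v))"
proof -
  have "semidecidable (\<lambda>v. count_axiom (v 0))"
    unfolding count_axiom_def judgement_def by (intro semidecidable_intros computable_intros)
  moreover have "semidecidable (\<lambda>v. count_rule (v 0) (v 1) (v 2))"
    unfolding count_rule_def judgement_def
    by (intro semidecidable_intros semidecidable_universal computable_idx computable_intros)
  ultimately show ?thesis
    unfolding universal_count_def judgement_def
    by (intro semidecidable_derivable computable_intros assms)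
qed

lemma universal_count_iff:
  assumes "\<And>z v. universal e (idx e z) v \<longleftrightarrow> v = g z"
  shows "universal_count e z k \<longleftrightarrow> k = count g z"
proof
  have "\<forall>z k. c = judgement e z k \<longrightarrow> k = count g z" if "derivable count_axiom count_rule c" for c
    using that by induction (auto simp: count_axiom_def count_rule_def assms)
  then show "universal_count e z k \<Longrightarrow> k = count g z"
    unfolding universal_count_def by blast
  have "derivable count_axiom count_rule (judgement e z (count g z))"
  proof (induction z)
    case 0
    show ?case by (intro derivable_axiom) (auto simp: count_axiom_def)
  next
    case (Suc z)
    have "count_rule (judgement e z (count g z)) q (judgement e (Suc z) (count g (Suc z)))" for q
      by (auto simp: count_rule_def assms)
    with Suc show ?case by (blast intro: derivable_rule)
  qed
  then show "k = count g z \<Longrightarrow> universal_count e z k"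
    by (simp add: universal_count_def)
qed

text \<open>Self-reference needs no recursion theorem: \<open>\<rho>\<close> treats all candidates
  \<open>e\<close> at once, and only then is \<open>e\<close> chosen as a program for the reduction
  \<open>h\<close> of \<open>\<rho>\<close>.\<close>

lemma injective_reduction:
  fixes E :: "(nat \<Rightarrow> 'a) set" and bot :: 'a and \<mu> \<nu> :: "nat \<Rightarrow> 'a"
  assumes A1: "\<And>\<nu> f. \<nu> \<in> E \<Longrightarrow> partial_computable f \<Longrightarrow>
                 (\<lambda>n. case f n of Some m \<Rightarrow> \<nu> m | None \<Rightarrow> bot) \<in> E"
    and A3: "\<And>\<tau> G. \<tau> \<in> E \<Longrightarrow> enumerable G \<Longrightarrow>
                 \<exists>\<rho>\<in>E. (\<forall>x. x \<notin> G \<longrightarrow> \<rho> x = \<tau> x) \<and> (\<forall>x\<in>G. \<rho> x \<noteq> bot)"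
    and opt: "effectively_optimal E \<nu>" and \<mu>: "\<mu> \<in> E"
  obtains f where "total_computable f" "length_bounded f" "inj f" "\<And>x. x < f x" "\<And>x. \<mu> x = \<nu> (f x)"
proof -
  \<comment> \<open>Values are required to exist and to differ, which keeps the condition
    semidecidable.\<close>
  define separated where "separated e z \<longleftrightarrow> (\<forall>y<Suc z. \<forall>y'<y. \<exists>v v'. universal e (idx e y) v \<and>
    universal e (idx e y') v' \<and> v \<noteq> v')" for e z
  have "semidecidable (\<lambda>v. \<exists>e z. v 0 = idx e z \<and> separated e z \<and> universal_count e z (v 1))"
    unfolding separated_def by (intro semidecidable_intros semidecidable_universal
        semidecidable_universal_count computable_idx computable_intros)
  then obtain s where s: "partial_computable s"
      "\<And>n. s n \<noteq> None \<longleftrightarrow> (\<exists>k e z. n = idx e z \<and> separated e z \<and> universal_count e z k)"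
      "\<And>n k. s n = Some k \<Longrightarrow> \<exists>e z. n = idx e z \<and> separated e z \<and> universal_count e z k"
    using semidecidable_selection[of "\<lambda>n k. \<exists>e z. n = idx e z \<and> separated e z \<and> universal_count e z k"]
    by blast
  \<comment> \<open>First members of collision classes; the earlier values must again exist and
    differ, so \<open>G\<close> is enumerable.\<close>
  define G where "G = {n. \<exists>e y x v. n = idx e y \<and> y < x \<and> universal e (idx e x) v \<and>
    universal e (idx e y) v \<and> (\<forall>y'<y. \<exists>v'. universal e (idx e y') v' \<and> v' \<noteq> v)}"
  have "enumerable G"
    by (rule enumerable_semidecidable, unfold G_def mem_Collect_eq)
      (intro semidecidable_intros semidecidable_universal computable_idx computable_intros)
  from A3[OF A1[OF \<mu> s(1)] this] obtain \<rho> where \<rho>: "\<rho> \<in> E"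
      "\<And>n. n \<notin> G \<Longrightarrow> \<rho> n = (case s n of Some m \<Rightarrow> \<mu> m | None \<Rightarrow> bot)" "\<And>n. n \<in> G \<Longrightarrow> \<rho> n \<noteq> bot"
    by blast
  from opt \<rho>(1) obtain h where h: "total_computable h" "length_bounded h" "\<And>n. \<rho> n = \<nu> (h n)"
    unfolding effectively_optimal_def by blast
  obtain r where "\<And>n y. eval r [n] y \<longleftrightarrow> y = h n"
    using h(1) unfolding total_computable_def partial_computable_def by (metis option.inject)
  then obtain e where U: "\<And>n v. universal e n v \<longleftrightarrow> v = h n"
    using universal_code_iff by metis
  define g where "g z = h (idx e z)" for z
  have U': "universal e (idx e z) v \<longleftrightarrow> v = g z" for z v
    by (simp add: U g_def)
  note K = universal_count_iff[OF U']
  have G_iff: "idx e y \<in> G \<longleftrightarrow> (\<exists>x>y. g x = g y) \<and> (\<forall>y'<y. g y' \<noteq> g y)" for y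
    unfolding G_def by (auto simp: idx_eq_iff U')
  have separated_iff: "separated e z \<longleftrightarrow> (\<forall>y<Suc z. \<forall>y'<y. g y \<noteq> g y')" for z
    unfolding separated_def U' by auto
  have "g x \<noteq> g x'" if "x < x'" for x x'
  proof
    assume eq: "g x = g x'"
    \<comment> \<open>The first member \<open>y\<close> of the class lies in \<open>G\<close>, so
      \<open>\<rho>\<close> is not \<open>bot\<close> there. The later \<open>x'\<close> lies
      outside \<open>G\<close> and outside the domain of \<open>s\<close>, so \<open>\<rho>\<close>
      is \<open>bot\<close> there, although \<open>h\<close> sends both to the same value.\<close>
    define y where "y = (LEAST y. g y = g x)"
    have y: "g y = g x" "\<And>y'. y' < y \<Longrightarrow> g y' \<noteq> g x" "y \<le> x"
      unfolding y_def by (rule LeastI, rule refl) (auto dest: not_less_Least intro: Least_le)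
    then have "y < x'" using that by simp
    have "idx e y \<in> G"
      unfolding G_iff using y \<open>y < x'\<close> eq by auto
    moreover have "idx e x' \<notin> G"
      unfolding G_iff using y(1) \<open>y < x'\<close> eq by auto
    moreover have "\<not> separated e x'"
      unfolding separated_iff using y(1) \<open>y < x'\<close> eq by (metis lessI)
    then have "s (idx e x') = None"
      using s(2)[of "idx e x'"] by (auto simp: idx_eq_iff)
    ultimately have "\<rho> (idx e x') \<noteq> \<rho> (idx e y)"
      using \<rho>(2,3) by fastforce
    then show False using h(3) y(1) eq by (simp add: g_def)
  qed
  then have inj: "inj g" by (metis injI linorder_neqE_nat)
  \<comment> \<open>By injectivity the points \<open>idx e z\<close> avoid \<open>G\<close> and are
    all separated, so \<open>\<rho>\<close> follows \<open>\<mu>\<close> along the counter.\<close>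
  have \<nu>g: "\<nu> (g z) = \<mu> (count g z)" for z
  proof -
    have "separated e z" unfolding separated_iff using inj by (auto dest: injD)
    then have "s (idx e z) \<noteq> None" using s(2) K by blast
    then obtain k where k: "s (idx e z) = Some k" by blast
    from s(3)[OF k] have "k = count g z" by (auto simp: idx_eq_iff K)
    moreover have "idx e z \<notin> G" unfolding G_iff using inj by (auto dest: injD)
    ultimately show ?thesis using \<rho>(2) k h(3) by (simp add: g_def)
  qed
  \<comment> \<open>The value for \<open>x\<close> is the image at which the counter leaves
    \<open>x\<close>; the bound on \<open>z\<close> yields the length bound.\<close>
  have "semidecidable (\<lambda>v. \<exists>z. z < 2 * v 0 + 2 \<and> universal_count e z (v 0) \<and>
      universal e (idx e z) (v 1) \<and> v 0 < v 1)"
    by (intro semidecidable_intros semidecidable_universal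
        semidecidable_universal_count computable_idx computable_intros)
  moreover have "\<exists>y z. z < 2 * x + 2 \<and> universal_count e z x \<and> universal e (idx e z) y \<and> x < y" for x
    unfolding U' K using exists_count_less[OF inj, of x] by metis
  ultimately obtain f where f: "total_computable f"
    "\<And>x. \<exists>z. z < 2 * x + 2 \<and> universal_count e z x \<and> universal e (idx e z) (f x) \<and> x < f x"
    using total_computable_selection[of "\<lambda>x y. \<exists>z. z < 2 * x + 2 \<and> universal_count e z x \<and>
      universal e (idx e z) y \<and> x < y"] by blast
  then obtain Z where Z: "\<And>x. Z x < 2 * x + 2" "\<And>x. count g (Z x) = x" "\<And>x. f x = g (Z x)" "\<And>x. x < f x"
    unfolding U' K by metis
  obtain c where c: "\<And>x. blen (h x) \<le> blen x + c"
    using h(2) unfolding length_bounded_def by blast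
  \<comment> \<open>Pairing costs \<open>e + 3\<close>, by \<open>blen_mult_power\<close> with
    exponent \<open>e + 2\<close> and \<open>2 * Z x + 1 \<le> 4 * (x + 1)\<close>; the reduction
    \<open>h\<close> adds \<open>c\<close>.\<close>
  have "blen (f x) \<le> blen x + (e + 3 + c)" for x
  proof -
    have "idx e (Z x) \<le> 2 ^ (e + 2) * (x + 1)"
    proof -
      have "2 ^ e * (2 * Z x + 1) \<le> 2 ^ e * (4 * (x + 1))"
        by (rule mult_le_mono2) (use Z(1)[of x] in simp)
      also have "\<dots> = 2 ^ (e + 2) * (x + 1)"
        by (simp add: power_add algebra_simps)
      finally show ?thesis by (simp only: idx_def)
    qed
    then have "blen (idx e (Z x)) \<le> blen x + (e + 2 + 1)"
      using blen_mono blen_mult_power le_trans by blast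
    then show ?thesis using c[of "idx e (Z x)"] by (simp add: Z(3) g_def)
  qed
  then have "length_bounded f" unfolding length_bounded_def by blast
  \<comment> \<open>\<open>f x\<close> determines \<open>Z x\<close> by injectivity of
    \<open>g\<close>, and the counter at \<open>Z x\<close> is \<open>x\<close>.\<close>
  moreover have "inj f"
    using inj Z(2,3) by (metis injD injI)
  moreover have "\<mu> x = \<nu> (f x)" for x
    using \<nu>g[of "Z x"] Z(2,3) by simp
  ultimately show ?thesis using f(1) Z(4) that by blast
qed

section \<open>A computable Schroeder--Bernstein theorem\<close>

text \<open>\<open>derivable (origin_axiom f g) (origin_rule f g)\<close> holds of the code of \<open>(x, b)\<close> iff following the
  preimages under \<open>g\<close> and \<open>f\<close> alternately from \<open>x\<close> ends on the side of \<open>x\<close> (\<open>b = 1\<close>) or on the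
  other side (\<open>b = 0\<close>). It always ends, since \<open>f\<close> and \<open>g\<close> increase their arguments.\<close>

definition origin_axiom :: "(nat \<Rightarrow> nat) \<Rightarrow> (nat \<Rightarrow> nat) \<Rightarrow> nat \<Rightarrow> bool" where
  "origin_axiom f g c \<longleftrightarrow> (\<exists>x. c = prod_encode (x, 1) \<and> (\<forall>y<x. g y \<noteq> x)) \<or>
     (\<exists>y. c = prod_encode (g y, 0) \<and> (\<forall>x<y. f x \<noteq> y))"

definition origin_rule :: "(nat \<Rightarrow> nat) \<Rightarrow> (nat \<Rightarrow> nat) \<Rightarrow> nat \<Rightarrow> nat \<Rightarrow> nat \<Rightarrow> bool" where
  "origin_rule f g p q c \<longleftrightarrow> (\<exists>x b. p = prod_encode (x, b) \<and> c = prod_encode (g (f x), b))"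

text \<open>\<open>h\<close> applies \<open>f\<close> if the backward chain ends on the side of
  \<open>x\<close>, and the inverse of \<open>g\<close> otherwise. Both cases are semidecidable and
  exactly one holds, so \<open>h\<close> is computable.\<close>

lemma computable_Schroeder_Bernstein:
  assumes f: "total_computable f" "inj f" "\<And>x. x < f x"
    and g: "total_computable g" "inj g" "\<And>x. x < g x"
  obtains h where "bij h" "total_computable h" "\<And>x. h x = f x \<or> g (h x) = x"
proof -
  define side where "side x b \<longleftrightarrow> derivable (origin_axiom f g) (origin_rule f g) (prod_encode (x, b))" for x b
  \<comment> \<open>Preimages are smaller than their images, so the bounded conditions in
    \<open>origin_axiom\<close> exclude every preimage.\<close>
  have f_less: "(\<forall>x<y. f x \<noteq> y) \<longleftrightarrow> y \<notin> range f" for y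
    using f(3) by (auto simp: image_iff)
  have g_less: "(\<forall>y<x. g y \<noteq> x) \<longleftrightarrow> x \<notin> range g" for x
    using g(3) by (auto simp: image_iff)
  have side_cases: "(b = 1 \<and> x \<notin> range g) \<or> (b = 0 \<and> (\<exists>y. x = g y \<and> y \<notin> range f)) \<or>
      (\<exists>x'. x = g (f x') \<and> side x' b)" if "side x b" for x b
    using that unfolding side_def
    by (cases rule: derivable.cases) (auto simp: origin_axiom_def origin_rule_def f_less g_less)
  have side1: "side x 1" if "x \<notin> range g" for x
    unfolding side_def using that by (intro derivable_axiom) (auto simp: origin_axiom_def g_less)
  have side0: "side (g y) 0" if "y \<notin> range f" for y
    unfolding side_def using that by (intro derivable_axiom) (auto simp: origin_axiom_def f_less)
  have side_gf: "side (g (f x)) b" if "side x b" for x b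
    using derivable_rule[of "origin_axiom f g" "origin_rule f g", OF that[unfolded side_def] that[unfolded side_def]]
    unfolding side_def origin_rule_def by blast
  have gf_eq: "f x = f x' \<longleftrightarrow> x = x'" "g y = g y' \<longleftrightarrow> y = y'" for x x' y y'
    using f(2) g(2) by (auto dest: injD)
  have total: "side x 0 \<or> side x 1" for x
  proof (induction x rule: less_induct)
    case (less x)
    show ?case
    proof (cases "\<exists>x'. x = g (f x')")
      case True
      then obtain x' where x: "x = g (f x')" by blast
      have "x' < x" using f(3)[of x'] g(3)[of "f x'"] x by simp
      from less[OF this] show ?thesis using side_gf x by blast
    next
      case False
      then show ?thesis using side0 side1[of x] by (metis rangeE)
    qed
  qed
  have unique: "\<not> (side x 0 \<and> side x 1)" for x
  proof (induction x rule: less_induct)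
    case (less x)
    show ?case
    proof
      assume "side x 0 \<and> side x 1"
      then obtain x' where "x = g (f x')" "side x' 0" "side x' 1"
        using side_cases[of x 0] side_cases[of x 1] by (auto simp: gf_eq)
      moreover have "x' < g (f x')" using f(3)[of x'] g(3)[of "f x'"] by simp
      ultimately show False using less by blast
    qed
  qed
  define P where "P x y \<longleftrightarrow> (side x 1 \<and> y = f x) \<or> (side x 0 \<and> g y = x)" for x y
  have sd: "semidecidable (\<lambda>v. side (F v) (G v))" if "computable F" "computable G" for F G
  proof -
    note fg = computable_total_computable[OF f(1)] computable_total_computable[OF g(1)]
    have "semidecidable (\<lambda>v. origin_axiom f g (v 0))"
      unfolding origin_axiom_def by (intro semidecidable_intros computable_intros fg)
    moreover have "semidecidable (\<lambda>v. origin_rule f g (v 0) (v 1) (v 2))"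
      unfolding origin_rule_def by (intro semidecidable_intros computable_intros fg)
    ultimately show ?thesis
      unfolding side_def by (intro semidecidable_derivable computable_intros that)
  qed
  have "semidecidable (\<lambda>v. P (v 0) (v 1))"
    unfolding P_def by (intro semidecidable_intros sd computable_intros
        computable_total_computable[OF f(1)] computable_total_computable[OF g(1)])
  moreover have "\<exists>y. P x y" for x
    using total[of x] side_cases[of x 0] unfolding P_def by auto
  ultimately obtain h where h: "total_computable h" "\<And>x. P x (h x)"
    using total_computable_selection by blast
  have "inj h"
  proof (rule injI)
    fix x x' assume eq: "h x = h x'"
    \<comment> \<open>The two branches cannot meet: \<open>x\<close> and \<open>g (f x)\<close> lie
      on one chain and have the same origin.\<close>
    have mixed: False if "side x 1" "side x' 0" "g (f x) = x'" for x x'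
      using side_gf[OF that(1)] that(2,3) unique[of x'] by simp
    consider "f x = f x'" | "side x 1" "side x' 0" "g (f x) = x'"
      | "side x' 1" "side x 0" "g (f x') = x" | "x = x'"
      using h(2)[of x] h(2)[of x'] unfolding P_def eq by metis
    then show "x = x'"
      by cases (use mixed gf_eq(1) in blast)+
  qed
  \<comment> \<open>The origin of \<open>g y\<close> decides: for 0 the preimage is
    \<open>g y\<close>, otherwise \<open>y = f x\<close> and the preimage is
    \<open>x\<close>.\<close>
  moreover have "\<exists>x. h x = y" for y
  proof (cases "side (g y) 0")
    case True
    then have "h (g y) = y" using h(2)[of "g y"] unique[of "g y"] by (auto simp: P_def gf_eq)
    then show ?thesis by blast
  next
    case False
    then have "side (g y) 1" using total by blast
    with side_cases[OF this] obtain x where "y = f x" "side x 1" by (auto simp: gf_eq)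
    then have "h x = y" using h(2)[of x] unique[of x] by (auto simp: P_def)
    then show ?thesis by blast
  qed
  ultimately have "bij h" by (metis bijI surjI surj_def)
  then show ?thesis using h that unfolding P_def by blast
qed

theorem theorem7p3:
  fixes E :: "(nat \<Rightarrow> 'a) set" and bot :: 'a and \<nu> \<nu>' :: "nat \<Rightarrow> 'a"
  assumes A1: "\<And>\<nu> f. \<nu> \<in> E \<Longrightarrow> partial_computable f \<Longrightarrow>
                 (\<lambda>n. case f n of Some m \<Rightarrow> \<nu> m | None \<Rightarrow> bot) \<in> E"
    and A2: "\<exists>\<nu>\<in>E. \<forall>\<mu>\<in>E. \<exists>h. total_computable h \<and> (\<forall>n. \<mu> n = \<nu> (h n))"
    and A3: "\<And>\<tau> G. \<tau> \<in> E \<Longrightarrow> enumerable G \<Longrightarrow>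
                 \<exists>\<rho>\<in>E. (\<forall>x. x \<notin> G \<longrightarrow> \<rho> x = \<tau> x) \<and> (\<forall>x\<in>G. \<rho> x \<noteq> bot)"
    and opt: "effectively_optimal E \<nu>"
    and opt': "effectively_optimal E \<nu>'"
  shows "\<exists>h. bij h \<and> total_computable h \<and> length_bounded h \<and> length_bounded (inv h)
             \<and> (\<forall>x. \<nu>' x = \<nu> (h x))"
proof -
  have E: "\<nu> \<in> E" "\<nu>' \<in> E" using opt opt' by (simp_all add: effectively_optimal_def)
  obtain f where f: "total_computable f" "length_bounded f" "inj f" "\<And>x. x < f x" "\<And>x. \<nu>' x = \<nu> (f x)"
    using injective_reduction[OF A1 A3 opt E(2)] by blast
  obtain g where g: "total_computable g" "length_bounded g" "inj g" "\<And>x. x < g x" "\<And>x. \<nu> x = \<nu>' (g x)"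
    using injective_reduction[OF A1 A3 opt' E(1)] by blast
  obtain h where h: "bij h" "total_computable h" "\<And>x. h x = f x \<or> g (h x) = x"
    using computable_Schroeder_Bernstein[OF f(1,3,4) g(1,3,4)] by blast
  obtain c where c: "\<And>x. blen (f x) \<le> blen x + c"
    using f(2) unfolding length_bounded_def by blast
  obtain d where d: "\<And>x. blen (g x) \<le> blen x + d"
    using g(2) unfolding length_bounded_def by blast
  \<comment> \<open>If \<open>g (h x) = x\<close>, then \<open>h x < x\<close> and monotonicity of
    \<open>blen\<close> suffices; for the inverse the roles of \<open>f\<close> and \<open>g\<close>
    are exchanged.\<close>
  have "blen (h x) \<le> blen x + c" for x
    using h(3)[of x] c[of x] g(4)[of "h x"] blen_mono[of "h x" x] by auto
  moreover have "blen (inv h y) \<le> blen y + d" for y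
  proof -
    have "h (inv h y) = y" using h(1) by (simp add: bij_is_surj surj_f_inv_f)
    then show ?thesis
      using h(3)[of "inv h y"] d[of y] f(4)[of "inv h y"] blen_mono[of "inv h y" y] by auto
  qed
  \<comment> \<open>Along an edge of \<open>g\<close>,
    \<open>\<nu> (h x) = \<nu>' (g (h x)) = \<nu>' x\<close>.\<close>
  moreover have "\<nu>' x = \<nu> (h x)" for x
    using h(3)[of x] f(5)[of x] g(5)[of "h x"] by auto
  ultimately show ?thesis using h(1,2) unfolding length_bounded_def by blast
qed

end
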